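(* Let $r>1$ and let $H$ and $H'$ be $r$-uniform hypergraphs in each of which any two distinct edges intersect in at most one vertex. If $H$ can be obtained from $H'$ by adding pendant edges such that each pendant edge has $r-1$ vertices of degree $1$, then $\mathrm{pmd}(H)=\max\{\mathrm{pmd}(H'),\Delta(H)\}$.
   Context: A hypergraph is $r$-uniform if every edge has exactly $r$ vertices. The degree of a vertex is the number of edges containing it; $\Delta(H)$ is the maximal degree of a vertex of $H$. An edge of an $r$-uniform hypergraph is pendant if it has a vertex of degree one. A matching is a set of pairwise disjoint edges. A positive matching of $(V,E)$ is a matching $M\subseteq E$ for which there is $w:V\to\mathbb{Q}$ with $\sum_{i\in e}w(i)>0$ for $e\in M$ and $\sum_{i\in e}w(i)<0$ for $e\in E\setminus M$. A positive matching decomposition of $H=(V,E)$ is a partition $E=\bigcup_{i=1}^pM_i$ into pairwise disjoint subsets such that $M_i$ is a positive matching on $(V,E\setminus\bigcup_{j=1}^{i-1}M_j)$ for $i=1,\dots,p$. The smallest such $p$ is denoted $\mathrm{pmd}(H)$. *)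

theory Defs
  imports Complex_Main "HOL-Library.Disjoint_Sets"
begin

datatype 'a hypergraph = Hypergraph (verts: "'a set") (edges: "'a set set")

definition finite_hypergraph :: "'a hypergraph \<Rightarrow> bool" where
  "finite_hypergraph H \<longleftrightarrow> finite (verts H) \<and> (\<forall>e\<in>edges H. e \<subseteq> verts H)"

definition uniform_hypergraph :: "nat \<Rightarrow> 'a hypergraph \<Rightarrow> bool" where
  "uniform_hypergraph r H \<longleftrightarrow> (\<forall>e\<in>edges H. card e = r)"

definition linear_hypergraph :: "'a hypergraph \<Rightarrow> bool" where
  "linear_hypergraph H \<longleftrightarrow> (\<forall>e\<in>edges H. \<forall>f\<in>edges H. e \<noteq> f \<longrightarrow> card (e \<inter> f) \<le> 1)"

definition degree :: "'a hypergraph \<Rightarrow> 'a \<Rightarrow> nat" where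
  "degree H v = card {e \<in> edges H. v \<in> e}"

(* The inserted 0 only matters for the hypergraph without vertices,
   where Max would be applied to the empty set. *)
definition max_degree :: "'a hypergraph \<Rightarrow> nat" where
  "max_degree H = Max (insert 0 (degree H ` verts H))"

definition pendant_edge :: "'a hypergraph \<Rightarrow> 'a set \<Rightarrow> bool" where
  "pendant_edge H e \<longleftrightarrow> e \<in> edges H \<and> (\<exists>v\<in>e. degree H v = 1)"

(* Degrees are taken in the resulting hypergraph H. "Has r - 1 vertices of degree 1"
   is read like "has a vertex of degree one", that is, as "at least r - 1", so an added
   edge may also be disjoint from all other edges. *)
definition obtained_by_adding_pendant_edges ::
  "nat \<Rightarrow> 'a hypergraph \<Rightarrow> 'a hypergraph \<Rightarrow> bool" where
  "obtained_by_adding_pendant_edges r H' H \<longleftrightarrow>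
     (\<exists>F. F \<inter> edges H' = {} \<and> edges H = edges H' \<union> F \<and> verts H = verts H' \<union> \<Union>F \<and>
          (\<forall>e\<in>F. pendant_edge H e \<and> card {v \<in> e. degree H v = 1} \<ge> r - 1))"

definition matching :: "'a hypergraph \<Rightarrow> 'a set set \<Rightarrow> bool" where
  "matching H M \<longleftrightarrow> M \<subseteq> edges H \<and> disjoint M"

(* Only the values of w on the vertices matter. *)
definition positive_matching :: "'a hypergraph \<Rightarrow> 'a set set \<Rightarrow> bool" where
  "positive_matching H M \<longleftrightarrow> matching H M \<and>
     (\<exists>w :: 'a \<Rightarrow> rat. (\<forall>e\<in>M. (\<Sum>i\<in>e. w i) > 0) \<and> (\<forall>e\<in>edges H - M. (\<Sum>i\<in>e. w i) < 0))"

definition positive_matching_decomposition ::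
  "'a hypergraph \<Rightarrow> nat \<Rightarrow> (nat \<Rightarrow> 'a set set) \<Rightarrow> bool" where
  "positive_matching_decomposition H p M \<longleftrightarrow>
     edges H = (\<Union>i\<in>{1..p}. M i) \<and> disjoint_family_on M {1..p} \<and>
     (\<forall>i\<in>{1..p}. positive_matching (Hypergraph (verts H) (edges H - (\<Union>j\<in>{1..<i}. M j))) (M i))"

definition pmd :: "'a hypergraph \<Rightarrow> nat" where
  "pmd H = (LEAST p. \<exists>M. positive_matching_decomposition H p M)"

end

theory Submission
  imports Defs
begin

text \<open>
  Both \<open>pmd H'\<close> and \<open>\<Delta>(H)\<close> are lower bounds: a decomposition of \<open>H\<close> restricts to the
  subhypergraph \<open>H'\<close> (\<open>positive_matching_decomposition_restrict\<close>), and the edges through one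
  vertex lie in different matchings (\<open>degree_le_decomposition_length\<close>).

  For the upper bound, put \<open>p = max (pmd H') (\<Delta>(H))\<close> and start from a decomposition
  \<open>M'\<^sub>1, \<dots>, M'\<^sub>p\<close> of \<open>H'\<close>, padded with empty matchings. The new edges can be
  distributed over these \<open>p\<close> classes freely, subject only to the classes staying matchings,
  because positivity comes for free: a new edge has a vertex of degree one, whose weight affects
  no other edge, so the sign of the new edge can be prescribed without disturbing any other
  (\<open>positive_matching_extend\<close>). To keep the classes matchings, note that a new edge meets other
  edges in at most one vertex \<open>v\<close>, since its other vertices have degree one. The old edges through
  \<open>v\<close> use up as many classes as there are such edges, and as
  \<open>degree H v \<le> p\<close>, enough classes are left over for the new edges through \<open>v\<close> to get pairwise
  different ones (\<open>free_classes_at_vertex\<close>). The choices at different vertices do not interact.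
\<close>

section \<open>Restriction, padding and existence of decompositions\<close>

lemma positive_matching_restrict:
  assumes "positive_matching H M" and "E \<subseteq> edges H"
  shows "positive_matching (Hypergraph V E) (M \<inter> E)"
proof -
  obtain w :: "'a \<Rightarrow> rat" where
    "\<forall>e\<in>M. (\<Sum>i\<in>e. w i) > 0" "\<forall>e\<in>edges H - M. (\<Sum>i\<in>e. w i) < 0"
    using assms(1) unfolding positive_matching_def by blast
  hence "(\<forall>e\<in>M \<inter> E. (\<Sum>i\<in>e. w i) > 0) \<and> (\<forall>e\<in>E - M \<inter> E. (\<Sum>i\<in>e. w i) < 0)"
    using assms(2) by blast
  moreover have "matching (Hypergraph V E) (M \<inter> E)"
    using assms(1) by (auto simp: positive_matching_def matching_def disjoint_def)
  ultimately show ?thesis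
    unfolding positive_matching_def by auto
qed

lemma positive_matching_decomposition_restrict:
  assumes dec: "positive_matching_decomposition H p M" and sub: "edges H' \<subseteq> edges H"
  shows "positive_matching_decomposition H' p (\<lambda>i. M i \<inter> edges H')"
  unfolding positive_matching_decomposition_def
proof (intro conjI ballI)
  show "edges H' = (\<Union>i\<in>{1..p}. M i \<inter> edges H')"
    using dec sub unfolding positive_matching_decomposition_def by auto
  show "disjoint_family_on (\<lambda>i. M i \<inter> edges H') {1..p}"
    using dec unfolding positive_matching_decomposition_def disjoint_family_on_def by blast
next
  fix i assume i: "i \<in> {1..p}"
  let ?E = "edges H' - (\<Union>j\<in>{1..<i}. M j \<inter> edges H')"
  have "positive_matching (Hypergraph (verts H) (edges H - (\<Union>j\<in>{1..<i}. M j))) (M i)"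
    using dec i unfolding positive_matching_decomposition_def by blast
  hence "positive_matching (Hypergraph (verts H') ?E) (M i \<inter> ?E)"
    by (rule positive_matching_restrict) (use sub in auto)
  moreover have "M i \<inter> ?E = M i \<inter> edges H'"
  proof -
    have "M i \<inter> M j = {}" if "j \<in> {1..<i}" for j
    proof -
      have "j \<in> {1..p}" "j \<noteq> i" using that i by auto
      thus ?thesis
        using dec i unfolding positive_matching_decomposition_def disjoint_family_on_def by blast
    qed
    thus ?thesis by blast
  qed
  ultimately show "positive_matching (Hypergraph (verts H') ?E) (M i \<inter> edges H')"
    by simp
qed

lemma positive_matching_decomposition_pad:
  assumes dec: "positive_matching_decomposition H p M" and "p \<le> q"
  shows "\<exists>N. positive_matching_decomposition H q N"
proof -
  let ?N = "\<lambda>i. if i \<le> p then M i else {}"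
  have all: "edges H = (\<Union>i\<in>{1..p}. M i)"
    using dec unfolding positive_matching_decomposition_def by blast
  have "positive_matching (Hypergraph (verts H) (edges H - (\<Union>j\<in>{1..<i}. ?N j))) (?N i)"
    if i: "i \<in> {1..q}" for i
  proof (cases "i \<le> p")
    case True
    hence "i \<in> {1..p}" using i by simp
    have "(\<Union>j\<in>{1..<i}. ?N j) = (\<Union>j\<in>{1..<i}. M j)"
      by (rule SUP_cong) (use True in auto)
    moreover have "positive_matching (Hypergraph (verts H) (edges H - (\<Union>j\<in>{1..<i}. M j))) (M i)"
      using dec \<open>i \<in> {1..p}\<close> unfolding positive_matching_decomposition_def by blast
    ultimately show ?thesis
      using True by simp
  next
    case False
    have rest: "edges H - (\<Union>j\<in>{1..<i}. ?N j) = {}"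
      unfolding all using False by fastforce
    show ?thesis
      unfolding rest using False by (simp add: positive_matching_def matching_def)
  qed
  moreover have "edges H = (\<Union>i\<in>{1..q}. ?N i)"
    unfolding all using \<open>p \<le> q\<close> by (fastforce split: if_splits)
  moreover have "disjoint_family_on ?N {1..q}"
    using dec unfolding positive_matching_decomposition_def disjoint_family_on_def by auto
  ultimately show ?thesis
    unfolding positive_matching_decomposition_def by blast
qed

text \<open>
  In a uniform hypergraph no edge contains another, so a weight that is mildly positive on
  \<open>e\<close> and strongly negative elsewhere singles out \<open>e\<close>.
\<close>
lemma positive_matching_singleton:
  assumes "r > 0" and unif: "\<And>f. f \<in> E \<Longrightarrow> card f = r" and "e \<in> E"
  shows "positive_matching (Hypergraph V E) {e}"
proof -
  let ?w = "\<lambda>x. if x \<in> e then 1 else - rat_of_nat r"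
  have fin: "finite f" if "f \<in> E" for f
    using unif[OF that] \<open>r > 0\<close> by (simp add: card_ge_0_finite)
  have "(\<Sum>x\<in>e. ?w x) > 0"
    using unif[OF \<open>e \<in> E\<close>] \<open>r > 0\<close> by simp
  moreover have "(\<Sum>x\<in>f. ?w x) < 0" if f: "f \<in> E" "f \<noteq> e" for f
  proof -
    have "\<not> f \<subseteq> e"
      using card_subset_eq[OF fin[OF \<open>e \<in> E\<close>], of f] unif f \<open>e \<in> E\<close> by metis
    then obtain y where y: "y \<in> f" "y \<notin> e" by blast
    have "(\<Sum>x\<in>f. ?w x) = - rat_of_nat r + (\<Sum>x\<in>f - {y}. ?w x)"
      using y fin[OF f(1)] by (simp add: sum.remove)
    also have "(\<Sum>x\<in>f - {y}. ?w x) \<le> (\<Sum>x\<in>f - {y}. 1)"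
      by (rule sum_mono) auto
    also have "\<dots> = rat_of_nat (r - 1)"
      using y fin[OF f(1)] unif[OF f(1)] by simp
    finally show ?thesis
      using \<open>r > 0\<close> by (simp add: of_nat_diff)
  qed
  ultimately show ?thesis
    using \<open>e \<in> E\<close> by (auto simp: positive_matching_def matching_def intro!: exI[of _ ?w])
qed

text \<open>
  Removing the edges one by one shows that the set in the definition of \<open>pmd\<close> is inhabited, so
  that its least element is attained.
\<close>
lemma positive_matching_decomposition_exists:
  assumes "r > 0" and "finite_hypergraph H" and "uniform_hypergraph r H"
  shows "\<exists>p M. positive_matching_decomposition H p M"
proof -
  have "finite (edges H)"
    using assms(2) unfolding finite_hypergraph_def
    by (meson Pow_iff finite_Pow_iff rev_finite_subset subsetI)
  then obtain h where h: "bij_betw h {1..card (edges H)} (edges H)"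
    using ex_bij_betw_nat_finite_1 by blast
  let ?p = "card (edges H)"
  have "positive_matching (Hypergraph (verts H) (edges H - (\<Union>j\<in>{1..<i}. {h j}))) {h i}"
    if i: "i \<in> {1..?p}" for i
  proof (rule positive_matching_singleton[OF \<open>r > 0\<close>])
    show "card f = r" if "f \<in> edges H - (\<Union>j\<in>{1..<i}. {h j})" for f
      using that assms(3) unfolding uniform_hypergraph_def by blast
    have "h i \<noteq> h j" if "j \<in> {1..<i}" for j
    proof -
      have "j \<in> {1..?p}" "i \<noteq> j" using that i by auto
      thus ?thesis using h i unfolding bij_betw_def inj_on_def by blast
    qed
    moreover have "h i \<in> edges H"
      using h i bij_betwE by blast
    ultimately show "h i \<in> edges H - (\<Union>j\<in>{1..<i}. {h j})"
      by blast
  qed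
  moreover have "edges H = (\<Union>i\<in>{1..?p}. {h i})"
    using h unfolding bij_betw_def by blast
  moreover have "disjoint_family_on (\<lambda>i. {h i}) {1..?p}"
    using h unfolding disjoint_family_on_def bij_betw_def inj_on_def by blast
  ultimately show ?thesis
    unfolding positive_matching_decomposition_def by blast
qed

lemma pmd_attained:
  assumes "r > 0" and "finite_hypergraph H" and "uniform_hypergraph r H"
  obtains M where "positive_matching_decomposition H (pmd H) M"
  using LeastI_ex[OF positive_matching_decomposition_exists[OF assms]] unfolding pmd_def by blast

lemma pmd_le: "positive_matching_decomposition H p M \<Longrightarrow> pmd H \<le> p"
  unfolding pmd_def by (rule Least_le) blast

section \<open>Classes at a vertex\<close>

lemma decomposition_class_matching:
  assumes "positive_matching_decomposition H p M" and "i \<in> {1..p}"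
  shows "disjoint (M i)"
  using assms unfolding positive_matching_decomposition_def positive_matching_def matching_def
  by blast

lemma degree_le_decomposition_length:
  assumes dec: "positive_matching_decomposition H p M"
  shows "degree H v \<le> p"
proof -
  let ?A = "{e \<in> edges H. v \<in> e}"
  have "\<exists>i\<in>{1..p}. e \<in> M i" if "e \<in> ?A" for e
    using that dec unfolding positive_matching_decomposition_def by blast
  then obtain k where k: "\<And>e. e \<in> ?A \<Longrightarrow> k e \<in> {1..p} \<and> e \<in> M (k e)"
    by metis
  have "inj_on k ?A"
  proof (rule inj_onI)
    fix e f assume ef: "e \<in> ?A" "f \<in> ?A" "k e = k f"
    hence "e \<in> M (k e)" "f \<in> M (k e)" "e \<inter> f \<noteq> {}"
      using k[of e] k[of f] by auto
    thus "e = f"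
      using decomposition_class_matching[OF dec] k ef(1) unfolding disjoint_def by blast
  qed
  moreover have "k ` ?A \<subseteq> {1..p}"
    using k by blast
  ultimately have "card ?A \<le> card {1..p}"
    by (intro card_inj_on_le) auto
  thus ?thesis
    by (simp add: degree_def)
qed

text \<open>
  Different classes that are occupied at \<open>v\<close> are occupied by different edges of \<open>H\<close>, so the
  edges through \<open>v\<close> block at most as many classes as there are such edges, and at least
  \<open>card B\<close> of the \<open>p\<close> classes remain.
\<close>
lemma free_classes_at_vertex:
  assumes dec: "positive_matching_decomposition H p M"
    and "finite (edges H)" and "finite B"
    and le: "card {e \<in> edges H. v \<in> e} + card B \<le> p"
  shows "\<exists>c. inj_on c B \<and> c ` B \<subseteq> {i \<in> {1..p}. \<forall>e\<in>M i. v \<notin> e}"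
proof -
  let ?A = "{e \<in> edges H. v \<in> e}"
  let ?used = "{i \<in> {1..p}. \<exists>e\<in>M i. v \<in> e}"
  let ?free = "{i \<in> {1..p}. \<forall>e\<in>M i. v \<notin> e}"
  have "\<forall>i\<in>?used. \<exists>e. e \<in> M i \<and> v \<in> e"
    by blast
  from bchoice[OF this] obtain g where g: "\<And>i. i \<in> ?used \<Longrightarrow> g i \<in> M i \<and> v \<in> g i"
    by blast
  have "inj_on g ?used"
  proof (rule inj_onI)
    fix i j assume ij: "i \<in> ?used" "j \<in> ?used" "g i = g j"
    hence "g i \<in> M i \<inter> M j"
      using g[OF ij(1)] g[OF ij(2)] by simp
    thus "i = j"
      using dec ij unfolding positive_matching_decomposition_def disjoint_family_on_def by blast
  qed
  moreover have "g ` ?used \<subseteq> ?A"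
    using g dec unfolding positive_matching_decomposition_def by blast
  ultimately have "card ?used \<le> card ?A"
    using \<open>finite (edges H)\<close> by (intro card_inj_on_le) auto
  moreover have "card ?free = p - card ?used"
  proof -
    have "?free = {1..p} - ?used"
      by blast
    moreover have "card ({1..p} - ?used) = card {1..p} - card ?used"
      by (rule card_Diff_subset) auto
    ultimately show ?thesis
      by (simp only: card_atLeastAtMost)
  qed
  ultimately have "card B \<le> card ?free"
    using le by simp
  thus ?thesis
    using card_le_inj[of B ?free] \<open>finite B\<close> by auto
qed

section \<open>Adding edges with a private vertex\<close>

text \<open>
  An old weight may be kept on all vertices except the private vertices \<open>u f\<close> of the new edges.
  The weight of \<open>u f\<close> is chosen so that the total weight of \<open>f\<close> becomes \<open>1\<close> or \<open>-1\<close> as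
  desired.
\<close>
lemma positive_matching_extend:
  assumes pos: "positive_matching (Hypergraph V E) M"
    and fin: "\<And>f. f \<in> F \<Longrightarrow> finite f"
    and u: "\<And>f. f \<in> F \<Longrightarrow> u f \<in> f"
    and own: "\<And>f g. f \<in> F \<Longrightarrow> g \<in> E \<union> F \<Longrightarrow> u f \<in> g \<Longrightarrow> g = f"
    and "E \<inter> F = {}" and "N \<subseteq> F" and "disjoint (M \<union> N)"
  shows "positive_matching (Hypergraph V' (E \<union> F)) (M \<union> N)"
proof -
  obtain w :: "'a \<Rightarrow> rat" where
    w: "\<forall>e\<in>M. (\<Sum>i\<in>e. w i) > 0" "\<forall>e\<in>E - M. (\<Sum>i\<in>e. w i) < 0" and "M \<subseteq> E"
    using pos unfolding positive_matching_def matching_def by auto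
  have inj: "inj_on u F"
    using u own by (metis Un_iff inj_onI)
  let ?t = "\<lambda>f. (if f \<in> N then 1 else -1) - (\<Sum>y\<in>f - {u f}. w y)"
  let ?w = "\<lambda>x. if x \<in> u ` F then ?t (inv_into F u x) else w x"
  have old: "(\<Sum>x\<in>e. ?w x) = (\<Sum>x\<in>e. w x)" if "e \<in> E" for e
  proof (rule sum.cong[OF refl])
    fix x assume "x \<in> e"
    hence "x \<notin> u ` F"
      using own \<open>e \<in> E\<close> \<open>E \<inter> F = {}\<close> by blast
    thus "?w x = w x" by simp
  qed
  have new: "(\<Sum>x\<in>f. ?w x) = (if f \<in> N then 1 else -1)" if f: "f \<in> F" for f
  proof -
    have "(\<Sum>x\<in>f - {u f}. ?w x) = (\<Sum>x\<in>f - {u f}. w x)"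
    proof (rule sum.cong[OF refl])
      fix x assume x: "x \<in> f - {u f}"
      hence "x \<notin> u ` F"
        using own f by blast
      thus "?w x = w x" by simp
    qed
    moreover have "?w (u f) = ?t f"
      using f inv_into_f_f[OF inj f] by simp
    moreover have "(\<Sum>x\<in>f. ?w x) = ?w (u f) + (\<Sum>x\<in>f - {u f}. ?w x)"
      using fin[OF f] u[OF f] by (rule sum.remove)
    ultimately show ?thesis
      by simp
  qed
  have "(\<Sum>x\<in>e. ?w x) > 0" if "e \<in> M \<union> N" for e
  proof (cases "e \<in> E")
    case True
    hence "e \<in> M" using that \<open>N \<subseteq> F\<close> \<open>E \<inter> F = {}\<close> by blast
    thus ?thesis using old[OF True] w(1) by metis
  next
    case False
    hence "e \<in> N" "e \<in> F" using that \<open>N \<subseteq> F\<close> \<open>M \<subseteq> E\<close> by auto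
    thus ?thesis unfolding new[OF \<open>e \<in> F\<close>] by simp
  qed
  moreover have "(\<Sum>x\<in>e. ?w x) < 0" if "e \<in> E \<union> F - (M \<union> N)" for e
  proof (cases "e \<in> E")
    case True
    hence "e \<in> E - M" using that by blast
    thus ?thesis using old[OF True] w(2) by metis
  next
    case False
    hence "e \<notin> N" "e \<in> F" using that by auto
    thus ?thesis unfolding new[OF \<open>e \<in> F\<close>] by simp
  qed
  moreover have "matching (Hypergraph V' (E \<union> F)) (M \<union> N)"
    using assms \<open>M \<subseteq> E\<close> by (auto simp: matching_def)
  ultimately show ?thesis
    unfolding positive_matching_def hypergraph.sel by blast
qed

lemma positive_matching_decomposition_extend:
  assumes dec: "positive_matching_decomposition H' p M"
    and H: "edges H = edges H' \<union> F" and disj: "edges H' \<inter> F = {}"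
    and fin: "\<And>f. f \<in> F \<Longrightarrow> finite f"
    and u: "\<And>f. f \<in> F \<Longrightarrow> u f \<in> f"
    and own: "\<And>f g. f \<in> F \<Longrightarrow> g \<in> edges H \<Longrightarrow> u f \<in> g \<Longrightarrow> g = f"
    and c: "c ` F \<subseteq> {1..p}"
    and c_matching: "\<And>i. i \<in> {1..p} \<Longrightarrow> disjoint (M i \<union> {f \<in> F. c f = i})"
  shows "positive_matching_decomposition H p (\<lambda>i. M i \<union> {f \<in> F. c f = i})"
  unfolding positive_matching_decomposition_def
proof (intro conjI ballI)
  have all: "edges H' = (\<Union>i\<in>{1..p}. M i)"
    using dec unfolding positive_matching_decomposition_def by blast
  hence sub: "M i \<inter> F = {}" if "i \<in> {1..p}" for i
    using disj that by blast
  show "edges H = (\<Union>i\<in>{1..p}. M i \<union> {f \<in> F. c f = i})"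
    unfolding H all using c by auto
  show "disjoint_family_on (\<lambda>i. M i \<union> {f \<in> F. c f = i}) {1..p}"
    using dec sub unfolding positive_matching_decomposition_def disjoint_family_on_def by blast
  fix i assume i: "i \<in> {1..p}"
  let ?E = "edges H' - (\<Union>j\<in>{1..<i}. M j)"
  let ?F = "{f \<in> F. c f \<ge> i}"
  have "positive_matching (Hypergraph (verts H) (?E \<union> ?F)) (M i \<union> {f \<in> F. c f = i})"
  proof (rule positive_matching_extend)
    show "positive_matching (Hypergraph (verts H') ?E) (M i)"
      using dec i unfolding positive_matching_decomposition_def by blast
    show "g = f" if "f \<in> ?F" "g \<in> ?E \<union> ?F" "u f \<in> g" for f g
      using own that H by blast
    show "disjoint (M i \<union> {f \<in> F. c f = i})"
      using c_matching i .
  qed (use fin u disj in auto)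
  moreover have "?E \<union> ?F = edges H - (\<Union>j\<in>{1..<i}. M j \<union> {f \<in> F. c f = j})"
  proof -
    have "M j \<inter> F = {}" if "j \<in> {1..<i}" for j
      using sub that i by simp
    moreover have "c f \<ge> 1" if "f \<in> F" for f
      using c that by auto
    ultimately show ?thesis
      unfolding H using disj by (fastforce simp: not_le)
  qed
  ultimately show "positive_matching (Hypergraph (verts H)
      (edges H - (\<Union>j\<in>{1..<i}. M j \<union> {f \<in> F. c f = j}))) (M i \<union> {f \<in> F. c f = i})"
    by simp
qed

section \<open>Pendant edges\<close>

lemma degree_one_unique_edge:
  assumes "degree H v = 1" "e \<in> edges H" "v \<in> e" "f \<in> edges H" "v \<in> f"
  shows "e = f"
proof -
  obtain g where "{e \<in> edges H. v \<in> e} = {g}"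
    using assms(1) unfolding degree_def by (rule card_1_singletonE)
  thus ?thesis
    using assms(2-) by (metis (mono_tags, lifting) mem_Collect_eq singletonD)
qed

text \<open>
  With \<open>P\<close> saying that a vertex has degree one, \<open>a\<close> is the only vertex in which the pendant
  edge \<open>e\<close> can touch the rest; if \<open>P\<close> holds on all of \<open>e\<close>, any vertex serves as \<open>a\<close>,
  so isolated edges need no separate treatment.
\<close>
lemma attaching_vertex_exists:
  assumes "card e = r" "r > 0" "card {v \<in> e. P v} \<ge> r - 1"
  shows "\<exists>a\<in>e. \<forall>v\<in>e. v \<noteq> a \<longrightarrow> P v"
proof -
  have fin: "finite e"
    using assms by (simp add: card_ge_0_finite)
  have "card {v \<in> e. P v} + card {v \<in> e. \<not> P v} = card e"
    using fin by (subst card_Un_disjoint[symmetric]) (auto intro: arg_cong[where f = card])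
  hence "card {v \<in> e. \<not> P v} \<le> Suc 0"
    using assms by simp
  moreover have "e \<noteq> {}"
    using assms by auto
  ultimately show ?thesis
    using fin card_le_Suc0_iff_eq[of "{v \<in> e. \<not> P v}"]
    by (cases "{v \<in> e. \<not> P v} = {}") (simp, blast)+
qed

text \<open>
  The vertex \<open>a f\<close> is the only one in which \<open>f\<close> can meet another edge. A new edge \<open>f\<close> takes its
  class from the assignment at \<open>a f\<close>: two intersecting new edges have the same vertex \<open>a\<close>, hence
  different classes, and an old edge meeting \<open>f\<close> passes through \<open>a f\<close>, so its class
  is not free there.
\<close>
lemma pendant_edges_classes:
  assumes dec: "positive_matching_decomposition H' p M"
    and H: "edges H = edges H' \<union> F" and disj: "edges H' \<inter> F = {}"
    and fin: "finite (edges H)"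
    and a: "\<And>f. f \<in> F \<Longrightarrow> a f \<in> f"
    and meet: "\<And>f g x. f \<in> F \<Longrightarrow> g \<in> edges H \<Longrightarrow> f \<noteq> g \<Longrightarrow> x \<in> f \<Longrightarrow> x \<in> g \<Longrightarrow> x = a f"
    and deg: "\<And>f. f \<in> F \<Longrightarrow> degree H (a f) \<le> p"
  shows "\<exists>c. c ` F \<subseteq> {1..p} \<and> (\<forall>i\<in>{1..p}. disjoint (M i \<union> {f \<in> F. c f = i}))"
proof -
  let ?B = "\<lambda>v. {f \<in> F. v \<in> f}"
  have "\<forall>v\<in>a ` F. \<exists>c. inj_on c (?B v) \<and>
      c ` ?B v \<subseteq> {i \<in> {1..p}. \<forall>e\<in>M i. v \<notin> e}"
  proof (rule ballI, rule free_classes_at_vertex[OF dec])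
    fix v assume v: "v \<in> a ` F"
    show "finite (edges H')" "finite (?B v)"
      using fin H by auto
    have "card {e \<in> edges H'. v \<in> e} + card (?B v) = degree H v"
      unfolding degree_def using fin H disj
      by (subst card_Un_disjoint[symmetric]) (auto intro: arg_cong[where f = card])
    thus "card {e \<in> edges H'. v \<in> e} + card (?B v) \<le> p"
      using deg v by auto
  qed
  from bchoice[OF this] obtain k where
    inj: "\<And>v. v \<in> a ` F \<Longrightarrow> inj_on (k v) (?B v)" and
    free: "\<And>v. v \<in> a ` F \<Longrightarrow> k v ` ?B v \<subseteq> {i \<in> {1..p}. \<forall>e\<in>M i. v \<notin> e}"
    by blast
  define c where "c f = k (a f) f" for f
  have c_free: "c f \<in> {i \<in> {1..p}. \<forall>e\<in>M i. a f \<notin> e}" if "f \<in> F" for f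
    using free[of "a f"] a that unfolding c_def by blast
  have M_sub: "M i \<subseteq> edges H'" if "i \<in> {1..p}" for i
    using dec that unfolding positive_matching_decomposition_def by blast
  have new_old: "f \<inter> e = {}" if "f \<in> F" "c f = i" "e \<in> M i" for f e i
  proof (rule ccontr)
    assume "f \<inter> e \<noteq> {}"
    then obtain x where x: "x \<in> f" "x \<in> e" by blast
    have "e \<in> edges H'"
      using M_sub c_free that by blast
    hence "x = a f"
      using meet[OF \<open>f \<in> F\<close> _ _ x] H disj \<open>f \<in> F\<close> by blast
    thus False
      using c_free that x by blast
  qed
  have new_new: "f \<inter> g = {}" if "f \<in> F" "g \<in> F" "c f = c g" "f \<noteq> g" for f g
  proof (rule ccontr)
    assume "f \<inter> g \<noteq> {}"
    then obtain x where x: "x \<in> f" "x \<in> g" by blast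
    have "x = a f" "x = a g"
      using meet x that H by auto
    hence "k x f = k x g" "x \<in> a ` F"
      using that unfolding c_def by auto
    thus False
      using inj[of x] that x unfolding inj_on_def by blast
  qed
  have "disjoint (M i \<union> {f \<in> F. c f = i})" if i: "i \<in> {1..p}" for i
    unfolding disjoint_def
  proof (intro ballI impI)
    fix e f assume "e \<in> M i \<union> {f \<in> F. c f = i}" "f \<in> M i \<union> {f \<in> F. c f = i}" "e \<noteq> f"
    moreover have "e \<inter> f = {}" if "e \<in> M i" "f \<in> M i"
      using disjointD[OF decomposition_class_matching[OF dec i] that \<open>e \<noteq> f\<close>] .
    moreover have "e \<inter> f = {}" if "f \<in> F" "c f = i" "e \<in> M i"
      using new_old[OF that] by (simp add: Int_commute)
    ultimately show "e \<inter> f = {}"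
      using new_old[of e i f] new_new[of e f] by (elim UnE) simp_all
  qed
  moreover have "c ` F \<subseteq> {1..p}"
    using c_free by blast
  ultimately show ?thesis
    by blast
qed

theorem corollary3p4:
  fixes r :: nat and H H' :: "'a hypergraph"
  assumes "r > 1"
    and "finite_hypergraph H" and "finite_hypergraph H'"
    and "uniform_hypergraph r H" and "uniform_hypergraph r H'"
    and "linear_hypergraph H" and "linear_hypergraph H'"
    and "obtained_by_adding_pendant_edges r H' H"
  shows "pmd H = max (pmd H') (max_degree H)"
proof (rule antisym)
  have "r > 0" using \<open>r > 1\<close> by simp
  obtain F where F: "F \<inter> edges H' = {} \<and> edges H = edges H' \<union> F \<and>
      verts H = verts H' \<union> \<Union>F \<and>
      (\<forall>e\<in>F. pendant_edge H e \<and> card {v \<in> e. degree H v = 1} \<ge> r - 1)"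
    using assms(8) unfolding obtained_by_adding_pendant_edges_def ..
  have disj: "edges H' \<inter> F = {}"
    using F by (simp add: Int_commute)
  have H: "edges H = edges H' \<union> F"
    using F by (elim conjE)
  have pendant: "pendant_edge H f" and leaves: "card {v \<in> f. degree H v = 1} \<ge> r - 1"
    if "f \<in> F" for f
    using F that by simp_all
  have finV: "finite (verts H)" and in_V: "\<And>e. e \<in> edges H \<Longrightarrow> e \<subseteq> verts H"
    using assms(2) unfolding finite_hypergraph_def by auto
  have degree_le: "degree H v \<le> max_degree H" if "v \<in> verts H" for v
    unfolding max_degree_def using finV that by (intro Max_ge) auto
  show "max (pmd H') (max_degree H) \<le> pmd H"
  proof -
    obtain M where M: "positive_matching_decomposition H (pmd H) M"
      using pmd_attained[OF \<open>r > 0\<close> assms(2,4)] .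
    have "pmd H' \<le> pmd H"
      using positive_matching_decomposition_restrict[OF M] H by (blast intro: pmd_le)
    moreover have "max_degree H \<le> pmd H"
      unfolding max_degree_def using finV degree_le_decomposition_length[OF M] by auto
    ultimately show ?thesis
      by simp
  qed
  show "pmd H \<le> max (pmd H') (max_degree H)"
  proof -
    let ?p = "max (pmd H') (max_degree H)"
    obtain M' where "positive_matching_decomposition H' (pmd H') M'"
      using pmd_attained[OF \<open>r > 0\<close> assms(3,5)] .
    then obtain M where M: "positive_matching_decomposition H' ?p M"
      using positive_matching_decomposition_pad[of H' "pmd H'" M' ?p] by auto
    have "\<exists>u\<in>f. degree H u = 1" if "f \<in> F" for f
      using pendant[OF that] unfolding pendant_edge_def by blast
    then obtain u where u: "\<And>f. f \<in> F \<Longrightarrow> u f \<in> f \<and> degree H (u f) = 1"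
      by metis
    have "\<exists>a\<in>f. \<forall>v\<in>f. v \<noteq> a \<longrightarrow> degree H v = 1" if "f \<in> F" for f
      using attaching_vertex_exists[OF _ \<open>r > 0\<close> leaves[OF that]] assms(4) H that
      unfolding uniform_hypergraph_def by blast
    then obtain a where a: "\<And>f. f \<in> F \<Longrightarrow> a f \<in> f"
      and a_only: "\<And>f v. f \<in> F \<Longrightarrow> v \<in> f \<Longrightarrow> v \<noteq> a f \<Longrightarrow> degree H v = 1"
      by metis
    have meet: "x = a f" if "f \<in> F" "g \<in> edges H" "f \<noteq> g" "x \<in> f" "x \<in> g" for f g x
      using degree_one_unique_edge[of H x f g] a_only that H by blast
    have finE: "finite (edges H)"
      using in_V finV by (meson Pow_iff finite_Pow_iff rev_finite_subset subsetI)
    have deg: "degree H (a f) \<le> ?p" if "f \<in> F" for f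
      using degree_le[of "a f"] in_V[of f] a[OF that] H that by (auto simp: le_max_iff_disj)
    have "\<exists>c. c ` F \<subseteq> {1..?p} \<and> (\<forall>i\<in>{1..?p}. disjoint (M i \<union> {f \<in> F. c f = i}))"
    proof (rule pendant_edges_classes[OF M H disj finE])
      show "a f \<in> f" if "f \<in> F" for f
        using a[OF that] .
      show "x = a f" if "f \<in> F" "g \<in> edges H" "f \<noteq> g" "x \<in> f" "x \<in> g" for f g x
        using meet[OF that] .
      show "degree H (a f) \<le> ?p" if "f \<in> F" for f
        using deg[OF that] .
    qed
    then obtain c where c: "c ` F \<subseteq> {1..?p}"
      "\<forall>i\<in>{1..?p}. disjoint (M i \<union> {f \<in> F. c f = i})"
      by (elim exE conjE)
    have "positive_matching_decomposition H ?p (\<lambda>i. M i \<union> {f \<in> F. c f = i})"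
    proof (rule positive_matching_decomposition_extend[OF M H disj, where u = u])
      show "finite f" if "f \<in> F" for f
        using in_V[of f] finV H that by (auto intro: finite_subset)
      show "u f \<in> f" if "f \<in> F" for f
        using u[OF that] ..
      show "g = f" if "f \<in> F" "g \<in> edges H" "u f \<in> g" for f g
        using degree_one_unique_edge[of H "u f" g f] u[of f] that H by simp
      show "c ` F \<subseteq> {1..?p}"
        using c(1) .
      show "disjoint (M i \<union> {f \<in> F. c f = i})" if "i \<in> {1..?p}" for i
        using c(2) that ..
    qed
    thus ?thesis
      by (rule pmd_le)
  qed
qed

end
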